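(* Let $R$ be a right coherent ring. For each functor $F$ in $\mathrm{Mod}\text{-}(\mathrm{mod}\text{-}R)$ there is an exact sequence $$0 \longrightarrow F_0 \longrightarrow F \longrightarrow (-,\nu(F)) \longrightarrow F_1 \longrightarrow 0$$ in $\mathrm{Mod}\text{-}(\mathrm{mod}\text{-}R)$ such that $F_0, F_1 \in \mathrm{Mod}_0\text{-}(\mathrm{mod}\text{-}R)$.
   Context: $\mathrm{Mod}\text{-}R$ is the category of all right $R$-modules and $\mathrm{mod}\text{-}R$ is the full subcategory of finitely presented modules (abelian since $R$ is right coherent). $\mathrm{Mod}\text{-}(\mathrm{mod}\text{-}R)$ is the abelian category of additive contravariant functors from $\mathrm{mod}\text{-}R$ to abelian groups. For $M\in\mathrm{Mod}\text{-}R$ write $(-,M)=\mathrm{Hom}_R(-,M)|_{\mathrm{mod}\text{-}R}$, and similarly $(-,f)$ for an $R$-homomorphism $f$. The flat objects of $\mathrm{Mod}\text{-}(\mathrm{mod}\text{-}R)$ are exactly the functors isomorphic to some $(-,M)$, $M\in \mathrm{Mod}\text{-}R$; they form the full subcategory $\mathcal{F}(\mathrm{mod}\text{-}R)$, and $M\mapsto (-,M)$ is fully faithful. A flat precover of $F$ is a morphism $\pi:(-,M)\to F$ such that $\mathrm{Hom}(G,(-,M))\to\mathrm{Hom}(G,F)$ is surjective for all flat $G$; it is special if $\mathrm{Ext}^1(G,\mathrm{Ker}\,\pi)=0$ for all flat $G$. A special flat resolution of $F$ is an exact sequence $0\to(-,M_2)\xrightarrow{(-,d_2)}(-,M_1)\xrightarrow{(-,d_1)}(-,M_0)\xrightarrow{\varepsilon}F\to0$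 in which $\varepsilon$ and the induced map $(-,M_1)\to\mathrm{Ker}\,\varepsilon$ are special flat precovers; every $F$ has one. The functor $\nu:\mathrm{Mod}\text{-}(\mathrm{mod}\text{-}R)\to\mathrm{Mod}\text{-}R$ is defined by $\nu(F)=\mathrm{Coker}(M_1\xrightarrow{d_1}M_0)$ for a special flat resolution of $F$ (independent of the choice up to isomorphism), and on morphisms by lifting to special flat resolutions. $\mathrm{Mod}_0\text{-}(\mathrm{mod}\text{-}R)$ is the full subcategory of all $F$ with $\nu(F)=0$, equivalently $F(R)=0$. *)

theory Defs
  imports "HOL-Algebra.Algebra"
begin

section \<open>Right modules\<close>

text \<open>The HOL-Algebra record for modules is tied to commutative rings. Here a right module is a
  commutative group in the sense of HOL-Algebra (so the module addition is the operation called
  \<open>mult\<close>, and the zero of the module is the one called \<open>one\<close>) together with a right action;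
  \<open>ract M x r\<close> is the product \<open>x r\<close>.\<close>

record ('r, 'm) rmod = "'m monoid" +
  ract :: "'m \<Rightarrow> 'r \<Rightarrow> 'm"

locale right_module =
  fixes R :: "'r ring" and M :: "('r, 'm) rmod"
  assumes ring_R: "ring R"
    and comm_group_M: "comm_group M"
    and ract_closed: "\<lbrakk>x \<in> carrier M; r \<in> carrier R\<rbrakk> \<Longrightarrow> ract M x r \<in> carrier M"
    and ract_add_left: "\<lbrakk>x \<in> carrier M; y \<in> carrier M; r \<in> carrier R\<rbrakk>
      \<Longrightarrow> ract M (x \<otimes>\<^bsub>M\<^esub> y) r = ract M x r \<otimes>\<^bsub>M\<^esub> ract M y r"
    and ract_add_right: "\<lbrakk>x \<in> carrier M; r \<in> carrier R; s \<in> carrier R\<rbrakk>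
      \<Longrightarrow> ract M x (r \<oplus>\<^bsub>R\<^esub> s) = ract M x r \<otimes>\<^bsub>M\<^esub> ract M x s"
    and ract_assoc: "\<lbrakk>x \<in> carrier M; r \<in> carrier R; s \<in> carrier R\<rbrakk>
      \<Longrightarrow> ract M x (r \<otimes>\<^bsub>R\<^esub> s) = ract M (ract M x r) s"
    and ract_one: "x \<in> carrier M \<Longrightarrow> ract M x \<one>\<^bsub>R\<^esub> = x"

text \<open>Homomorphisms are extensional, so that equal homomorphisms are equal as HOL functions.\<close>

definition rhom :: "'r ring \<Rightarrow> ('r, 'm) rmod \<Rightarrow> ('r, 'n) rmod \<Rightarrow> ('m \<Rightarrow> 'n) set" where
  "rhom R M N = {f \<in> hom M N \<inter> extensional (carrier M).
     \<forall>x\<in>carrier M. \<forall>r\<in>carrier R. f (ract M x r) = ract N (f x) r}"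

definition rmod_iso :: "'r ring \<Rightarrow> ('r, 'm) rmod \<Rightarrow> ('r, 'n) rmod \<Rightarrow> bool" where
  "rmod_iso R M N \<longleftrightarrow> (\<exists>f\<in>rhom R M N. bij_betw f (carrier M) (carrier N))"

definition zero_grp :: "('m, 'x) monoid_scheme \<Rightarrow> bool" where
  "zero_grp M \<longleftrightarrow> carrier M = {\<one>\<^bsub>M\<^esub>}"

definition rsubmodule :: "'r ring \<Rightarrow> 'm set \<Rightarrow> ('r, 'm) rmod \<Rightarrow> bool" where
  "rsubmodule R I M \<longleftrightarrow> subgroup I M \<and> (\<forall>x\<in>I. \<forall>r\<in>carrier R. ract M x r \<in> I)"

definition regular_rmod :: "'r ring \<Rightarrow> ('r, 'r) rmod" where
  "regular_rmod R = \<lparr>carrier = carrier R, monoid.mult = add R, one = \<zero>\<^bsub>R\<^esub>, ract = monoid.mult R\<rparr>"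

definition free_rmod :: "'r ring \<Rightarrow> nat \<Rightarrow> ('r, nat \<Rightarrow> 'r) rmod" where
  "free_rmod R n = \<lparr>carrier = {..<n} \<rightarrow>\<^sub>E carrier R,
     monoid.mult = (\<lambda>v w. \<lambda>i\<in>{..<n}. v i \<oplus>\<^bsub>R\<^esub> w i),
     one = (\<lambda>i\<in>{..<n}. \<zero>\<^bsub>R\<^esub>),
     ract = (\<lambda>v r. \<lambda>i\<in>{..<n}. v i \<otimes>\<^bsub>R\<^esub> r)\<rparr>"

definition fin_gen :: "'r ring \<Rightarrow> ('r, 'm) rmod \<Rightarrow> bool" where
  "fin_gen R M \<longleftrightarrow> (\<exists>n. \<exists>p\<in>rhom R (free_rmod R n) M. p ` carrier (free_rmod R n) = carrier M)"

definition fin_pres :: "'r ring \<Rightarrow> ('r, 'm) rmod \<Rightarrow> bool" where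
  "fin_pres R M \<longleftrightarrow> (\<exists>n. \<exists>p\<in>rhom R (free_rmod R n) M.
     p ` carrier (free_rmod R n) = carrier M \<and>
     fin_gen R ((free_rmod R n)\<lparr>carrier := kernel (free_rmod R n) M p\<rparr>))"

definition right_coherent :: "'r ring \<Rightarrow> bool" where
  "right_coherent R \<longleftrightarrow> ring R \<and>
     (\<forall>I. rsubmodule R I (regular_rmod R) \<and> fin_gen R ((regular_rmod R)\<lparr>carrier := I\<rparr>)
        \<longrightarrow> fin_pres R ((regular_rmod R)\<lparr>carrier := I\<rparr>))"

text \<open>The cokernel of \<open>d\<close> is the group of cosets of the image; \<open>r\<close> sends the coset of \<open>x\<close> to the
  coset of \<open>x r\<close>.\<close>

definition rcoker :: "('r, 'm) rmod \<Rightarrow> ('r, 'n) rmod \<Rightarrow> ('m \<Rightarrow> 'n) \<Rightarrow> ('r, 'n set) rmod" where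
  "rcoker M N d = \<lparr>carrier = carrier (N Mod (d ` carrier M)),
     monoid.mult = monoid.mult (N Mod (d ` carrier M)),
     one = one (N Mod (d ` carrier M)),
     ract = (\<lambda>C r. \<Union>x\<in>C. (d ` carrier M) #>\<^bsub>N\<^esub> ract N x r)\<rparr>"

section \<open>The functor category\<close>

text \<open>A finitely presented module is a quotient of some free module \<open>R\<^sup>n\<close>, so the type of sets of
  \<open>n\<close>-tuples contains an isomorphic copy of each of them (lemma \<open>modR_essentially_all\<close> below).
  The category of finitely presented modules is therefore taken with carriers in this type.\<close>

type_synonym 'r fpelt = "(nat \<Rightarrow> 'r) set"

definition modR :: "'r ring \<Rightarrow> ('r, 'r fpelt) rmod set" where
  "modR R = {A. right_module R A \<and> fin_pres R A}"

lemma modR_essentially_all: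
  fixes M :: "('r, 'm) rmod"
  assumes M: "right_module R M" and fp: "fin_pres R M"
  shows "\<exists>A\<in>modR R. rmod_iso R A M"
proof -
  interpret M: right_module R M by (rule M)
  interpret G: comm_group M by (rule M.comm_group_M)
  obtain n p where p: "p \<in> rhom R (free_rmod R n) M"
    and surj: "p ` carrier (free_rmod R n) = carrier M"
    and fg: "fin_gen R ((free_rmod R n)\<lparr>carrier := kernel (free_rmod R n) M p\<rparr>)"
    using fp unfolding fin_pres_def by blast
  define j where "j = (\<lambda>x. {v \<in> carrier (free_rmod R n). p v = x})"
  define k where "k = (\<lambda>S. p (SOME v. v \<in> S))"
  have kj: "k (j x) = x" if "x \<in> carrier M" for x
  proof -
    have "\<exists>v. v \<in> j x" using that surj unfolding j_def by force
    then have "(SOME v. v \<in> j x) \<in> j x" by (rule someI_ex)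
    then show ?thesis unfolding k_def j_def by simp
  qed
  define A where "A = \<lparr>carrier = j ` carrier M,
     monoid.mult = (\<lambda>S T. j (k S \<otimes>\<^bsub>M\<^esub> k T)), one = j \<one>\<^bsub>M\<^esub>,
     ract = (\<lambda>S r. j (ract M (k S) r))\<rparr>"
  have A_sel: "carrier A = j ` carrier M" "\<And>S T. S \<otimes>\<^bsub>A\<^esub> T = j (k S \<otimes>\<^bsub>M\<^esub> k T)"
    "\<one>\<^bsub>A\<^esub> = j \<one>\<^bsub>M\<^esub>" "\<And>S r. ract A S r = j (ract M (k S) r)"
    unfolding A_def by simp_all
  have "comm_group A"
  proof (rule comm_groupI)
    fix S assume "S \<in> carrier A"
    then obtain x where x: "x \<in> carrier M" "S = j x" unfolding A_sel by blast
    then show "\<exists>T\<in>carrier A. T \<otimes>\<^bsub>A\<^esub> S = \<one>\<^bsub>A\<^esub>"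
      by (intro bexI[of _ "j (inv\<^bsub>M\<^esub> x)"]) (simp_all add: A_sel kj)
  qed (auto simp: A_sel kj G.m_assoc G.m_comm G.m_lcomm)
  with M.ring_R have A: "right_module R A"
  proof (rule right_module.intro)
  qed (auto simp: A_sel kj M.ract_closed M.ract_add_left M.ract_add_right M.ract_assoc M.ract_one
      ring.ring_simprules[OF M.ring_R])
  let ?F = "free_rmod R n"
  define q where "q = (\<lambda>v\<in>carrier ?F. j (p v))"
  have pcl: "p v \<in> carrier M" if "v \<in> carrier ?F" for v
    using that surj by blast
  have ring: "ring R" by (rule M.ring_R)
  have Fcl: "v \<otimes>\<^bsub>?F\<^esub> w \<in> carrier ?F" if "v \<in> carrier ?F" "w \<in> carrier ?F" for v w
    using that unfolding free_rmod_def
    by (auto intro!: ring.ring_simprules(1)[OF ring])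
  have Fact: "ract ?F v r \<in> carrier ?F" if "v \<in> carrier ?F" "r \<in> carrier R" for v r
    using that unfolding free_rmod_def
    by (auto intro!: ring.ring_simprules(5)[OF ring])
  have q: "q \<in> rhom R ?F A"
    using p pcl Fcl Fact unfolding rhom_def q_def hom_def
    by (auto simp: A_sel kj)
  have q_surj: "q ` carrier ?F = carrier A"
    unfolding q_def A_sel surj[symmetric] by (simp add: image_image)
  have q_ker: "kernel ?F A q = kernel ?F M p"
  proof -
    have "q v = \<one>\<^bsub>A\<^esub> \<longleftrightarrow> p v = \<one>\<^bsub>M\<^esub>" if "v \<in> carrier ?F" for v
    proof
      assume "q v = \<one>\<^bsub>A\<^esub>"
      then have "k (j (p v)) = k (j \<one>\<^bsub>M\<^esub>)" using that by (simp add: q_def A_sel)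
      then show "p v = \<one>\<^bsub>M\<^esub>" using kj[OF pcl[OF that]] kj[OF G.one_closed] by simp
    next
      assume "p v = \<one>\<^bsub>M\<^esub>"
      then show "q v = \<one>\<^bsub>A\<^esub>" using that by (simp add: q_def A_sel)
    qed
    then show ?thesis unfolding kernel_def by blast
  qed
  have "fin_pres R A"
    unfolding fin_pres_def
    by (intro exI[of _ n] bexI[of _ q] conjI q q_surj) (simp only: q_ker fg)
  with A have "A \<in> modR R" unfolding modR_def by simp
  moreover have "restrict k (carrier A) \<in> rhom R A M"
    unfolding rhom_def hom_def by (auto simp: A_sel kj M.ract_closed)
  moreover have "bij_betw (restrict k (carrier A)) (carrier A) (carrier M)"
    by (rule bij_betw_byWitness[where f' = j]) (auto simp: A_sel kj)
  ultimately show ?thesis unfolding rmod_iso_def by blast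
qed

definition hom_grp :: "'r ring \<Rightarrow> ('r, 'a) rmod \<Rightarrow> ('r, 'm) rmod \<Rightarrow> ('a \<Rightarrow> 'm) monoid" where
  "hom_grp R A M = \<lparr>carrier = rhom R A M,
     monoid.mult = (\<lambda>f g. \<lambda>x\<in>carrier A. f x \<otimes>\<^bsub>M\<^esub> g x),
     one = (\<lambda>x\<in>carrier A. \<one>\<^bsub>M\<^esub>)\<rparr>"

text \<open>Contravariant functors: \<open>Arr F A B f\<close> is the map \<open>F f : F B \<rightarrow> F A\<close> for \<open>f : A \<rightarrow> B\<close>.
  Only the values on objects and morphisms of \<open>modR R\<close> matter.\<close>

record ('r, 'b) mfunctor =
  Obj :: "('r, 'r fpelt) rmod \<Rightarrow> 'b monoid"
  Arr :: "('r, 'r fpelt) rmod \<Rightarrow> ('r, 'r fpelt) rmod \<Rightarrow> ('r fpelt \<Rightarrow> 'r fpelt) \<Rightarrow> 'b \<Rightarrow> 'b"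

definition Mod_modR :: "'r ring \<Rightarrow> ('r, 'b) mfunctor set" where
  "Mod_modR R = {F.
     (\<forall>A\<in>modR R. comm_group (Obj F A)) \<and>
     (\<forall>A\<in>modR R. \<forall>B\<in>modR R. \<forall>f\<in>rhom R A B. Arr F A B f \<in> hom (Obj F B) (Obj F A)) \<and>
     (\<forall>A\<in>modR R. \<forall>x\<in>carrier (Obj F A). Arr F A A (\<lambda>a\<in>carrier A. a) x = x) \<and>
     (\<forall>A\<in>modR R. \<forall>B\<in>modR R. \<forall>C\<in>modR R. \<forall>f\<in>rhom R A B. \<forall>g\<in>rhom R B C. \<forall>x\<in>carrier (Obj F C).
        Arr F A C (compose (carrier A) g f) x = Arr F A B f (Arr F B C g x)) \<and>
     (\<forall>A\<in>modR R. \<forall>B\<in>modR R. \<forall>f\<in>rhom R A B. \<forall>g\<in>rhom R A B. \<forall>x\<in>carrier (Obj F B).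
        Arr F A B (f \<otimes>\<^bsub>hom_grp R A B\<^esub> g) x = Arr F A B f x \<otimes>\<^bsub>Obj F A\<^esub> Arr F A B g x)}"

type_synonym ('r, 'b, 'c) mtrans = "('r, 'r fpelt) rmod \<Rightarrow> 'b \<Rightarrow> 'c"

definition nat_trans :: "'r ring \<Rightarrow> ('r, 'b) mfunctor \<Rightarrow> ('r, 'c) mfunctor \<Rightarrow> ('r, 'b, 'c) mtrans \<Rightarrow> bool" where
  "nat_trans R F G \<eta> \<longleftrightarrow>
     (\<forall>A\<in>modR R. \<eta> A \<in> hom (Obj F A) (Obj G A)) \<and>
     (\<forall>A\<in>modR R. \<forall>B\<in>modR R. \<forall>f\<in>rhom R A B. \<forall>x\<in>carrier (Obj F B).
        \<eta> A (Arr F A B f x) = Arr G A B f (\<eta> B x))"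

text \<open>Kernels, images and cokernels in the functor category are computed objectwise; this is how
  monomorphisms, epimorphisms, exactness and kernels are rendered.\<close>

definition ntr_mono :: "'r ring \<Rightarrow> ('r, 'b) mfunctor \<Rightarrow> ('r, 'b, 'c) mtrans \<Rightarrow> bool" where
  "ntr_mono R F \<eta> \<longleftrightarrow> (\<forall>A\<in>modR R. inj_on (\<eta> A) (carrier (Obj F A)))"

definition ntr_epi :: "'r ring \<Rightarrow> ('r, 'b) mfunctor \<Rightarrow> ('r, 'c) mfunctor \<Rightarrow> ('r, 'b, 'c) mtrans \<Rightarrow> bool" where
  "ntr_epi R F G \<eta> \<longleftrightarrow> (\<forall>A\<in>modR R. \<eta> A ` carrier (Obj F A) = carrier (Obj G A))"

definition ntr_exact :: "'r ring \<Rightarrow> ('r, 'b) mfunctor \<Rightarrow> ('r, 'b, 'c) mtrans \<Rightarrow> ('r, 'c) mfunctor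
    \<Rightarrow> ('r, 'c, 'd) mtrans \<Rightarrow> ('r, 'd) mfunctor \<Rightarrow> bool" where
  "ntr_exact R F \<alpha> G \<beta> H \<longleftrightarrow>
     (\<forall>A\<in>modR R. \<alpha> A ` carrier (Obj F A) = kernel (Obj G A) (Obj H A) (\<beta> A))"

definition ker_fun :: "('r, 'b) mfunctor \<Rightarrow> ('r, 'c) mfunctor \<Rightarrow> ('r, 'b, 'c) mtrans \<Rightarrow> ('r, 'b) mfunctor" where
  "ker_fun F G \<eta> = \<lparr>Obj = (\<lambda>A. (Obj F A)\<lparr>carrier := kernel (Obj F A) (Obj G A) (\<eta> A)\<rparr>), Arr = Arr F\<rparr>"

definition mfun_iso :: "'r ring \<Rightarrow> ('r, 'b) mfunctor \<Rightarrow> ('r, 'c) mfunctor \<Rightarrow> bool" where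
  "mfun_iso R F G \<longleftrightarrow> (\<exists>\<eta>. nat_trans R F G \<eta> \<and> ntr_mono R F \<eta> \<and> ntr_epi R F G \<eta>)"

text \<open>The functor \<open>(-, M)\<close> and the natural transformation \<open>(-, d)\<close>.\<close>

definition homF :: "'r ring \<Rightarrow> ('r, 'm) rmod \<Rightarrow> ('r, 'r fpelt \<Rightarrow> 'm) mfunctor" where
  "homF R M = \<lparr>Obj = (\<lambda>A. hom_grp R A M), Arr = (\<lambda>A B f g. compose (carrier A) g f)\<rparr>"

definition homF_map :: "('m \<Rightarrow> 'n) \<Rightarrow> ('r, 'r fpelt \<Rightarrow> 'm, 'r fpelt \<Rightarrow> 'n) mtrans" where
  "homF_map d = (\<lambda>A g. compose (carrier A) d g)"

section \<open>Special flat resolutions and the functor nu\<close>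

definition flat_fun :: "'r ring \<Rightarrow> ('r, 'r fpelt \<Rightarrow> 'm) mfunctor \<Rightarrow> bool" where
  "flat_fun R G \<longleftrightarrow> G \<in> Mod_modR R \<and>
     (\<exists>M :: ('r, 'm) rmod. right_module R M \<and> mfun_iso R G (homF R M))"

text \<open>Vanishing of the Yoneda group \<open>Ext\<^sup>1(G, K)\<close>: every extension of \<open>G\<close> by \<open>K\<close> splits. As a set,
  the middle term at an object is in bijection with the product of the outer ones, so the
  value type \<open>'k \<times> 'g\<close> is large enough to contain every extension up to isomorphism.\<close>

definition Ext1_zero :: "'r ring \<Rightarrow> ('r, 'g) mfunctor \<Rightarrow> ('r, 'k) mfunctor \<Rightarrow> bool" where
  "Ext1_zero R G K \<longleftrightarrow>
     (\<forall>(E :: ('r, 'k \<times> 'g) mfunctor) \<iota> \<rho>.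
        E \<in> Mod_modR R \<and> nat_trans R K E \<iota> \<and> nat_trans R E G \<rho> \<and>
        ntr_mono R K \<iota> \<and> ntr_exact R K \<iota> E \<rho> G \<and> ntr_epi R E G \<rho>
        \<longrightarrow> (\<exists>\<sigma>. nat_trans R G E \<sigma> \<and> (\<forall>A\<in>modR R. \<forall>x\<in>carrier (Obj G A). \<rho> A (\<sigma> A x) = x)))"

text \<open>The modules \<open>M\<close> and all modules defining the flat functors \<open>G\<close> have carriers in the type \<open>'m\<close>,
  which plays the role of the universe for the category of all right modules.\<close>

definition special_flat_precover ::
    "'r ring \<Rightarrow> ('r, 'm) rmod \<Rightarrow> ('r, 'r fpelt \<Rightarrow> 'm, 'b) mtrans \<Rightarrow> ('r, 'b) mfunctor \<Rightarrow> bool" where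
  "special_flat_precover R M \<pi> F \<longleftrightarrow>
     right_module R M \<and> nat_trans R (homF R M) F \<pi> \<and>
     (\<forall>(G :: ('r, 'r fpelt \<Rightarrow> 'm) mfunctor) \<phi>. flat_fun R G \<and> nat_trans R G F \<phi> \<longrightarrow>
        (\<exists>\<psi>. nat_trans R G (homF R M) \<psi> \<and>
           (\<forall>A\<in>modR R. \<forall>x\<in>carrier (Obj G A). \<pi> A (\<psi> A x) = \<phi> A x))) \<and>
     (\<forall>(G :: ('r, 'r fpelt \<Rightarrow> 'm) mfunctor). flat_fun R G \<longrightarrow>
        Ext1_zero R G (ker_fun (homF R M) F \<pi>))"

definition special_flat_resolution ::
    "'r ring \<Rightarrow> ('r, 'm) rmod \<Rightarrow> ('m \<Rightarrow> 'm) \<Rightarrow> ('r, 'm) rmod \<Rightarrow> ('m \<Rightarrow> 'm) \<Rightarrow> ('r, 'm) rmod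
      \<Rightarrow> ('r, 'r fpelt \<Rightarrow> 'm, 'b) mtrans \<Rightarrow> ('r, 'b) mfunctor \<Rightarrow> bool" where
  "special_flat_resolution R M2 d2 M1 d1 M0 \<epsilon> F \<longleftrightarrow>
     right_module R M2 \<and> right_module R M1 \<and> right_module R M0 \<and>
     d2 \<in> rhom R M2 M1 \<and> d1 \<in> rhom R M1 M0 \<and> nat_trans R (homF R M0) F \<epsilon> \<and>
     ntr_mono R (homF R M2) (homF_map d2) \<and>
     ntr_exact R (homF R M2) (homF_map d2) (homF R M1) (homF_map d1) (homF R M0) \<and>
     ntr_exact R (homF R M1) (homF_map d1) (homF R M0) \<epsilon> F \<and>
     ntr_epi R (homF R M0) F \<epsilon> \<and>
     special_flat_precover R M0 \<epsilon> F \<and>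
     special_flat_precover R M1 (homF_map d1) (ker_fun (homF R M0) F \<epsilon>)"

text \<open>\<open>is_nu R F N\<close> says that \<open>N\<close> is a value of nu at \<open>F\<close>; the value depends on the chosen special
  flat resolution and is only determined up to isomorphism.\<close>

definition is_nu :: "'r ring \<Rightarrow> ('r, 'b) mfunctor \<Rightarrow> ('r, 'm) rmod \<Rightarrow> bool" where
  "is_nu R F N \<longleftrightarrow> right_module R N \<and>
     (\<exists>(M2 :: ('r, 'm) rmod) d2 M1 d1 M0 \<epsilon>.
        special_flat_resolution R M2 d2 M1 d1 M0 \<epsilon> F \<and> rmod_iso R N (rcoker M1 M0 d1))"

text \<open>The functors \<open>F\<close> with nu of \<open>F\<close> equal to zero, equivalently with \<open>F(R) = 0\<close>. Both descriptions
  are required: the second one keeps the definition meaningful for a functor that has no special flat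
  resolution by modules with carriers in \<open>'m\<close>. As the regular module itself does not live in the
  type of \<open>modR R\<close>, \<open>F\<close> is evaluated at its isomorphic copies there.\<close>

definition Mod0_modR :: "'r ring \<Rightarrow> 'm itself \<Rightarrow> ('r, 'b) mfunctor set" where
  "Mod0_modR R U = {F \<in> Mod_modR R.
     (\<forall>N :: ('r, 'm) rmod. is_nu R F N \<longrightarrow> zero_grp N) \<and>
     (\<forall>A\<in>modR R. rmod_iso R A (regular_rmod R) \<longrightarrow> zero_grp (Obj F A))}"

end

theory Submission
  imports Defs
begin

text \<open>Let \<open>p : M\<^sub>0 \<rightarrow> \<nu>(F)\<close> be the cokernel of \<open>d\<^sub>1\<close>. Since \<open>F\<close> is the cokernel of \<open>(-, d\<^sub>1)\<close>, the
  transformation \<open>(-, p)\<close> factors through \<open>\<epsilon>\<close>, which gives \<open>\<eta> : F \<rightarrow> (-, \<nu>(F))\<close>; take its kernel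
  and cokernel. At \<open>R\<close>, evaluation at a generator identifies \<open>(-, M)\<close> with \<open>M\<close>, so that \<open>\<eta>\<close> is an
  isomorphism there. A functor vanishing at \<open>R\<close> has \<open>\<nu> = 0\<close>, because \<open>d\<^sub>1\<close> is then surjective in
  any of its special flat resolutions.\<close>

subsection \<open>Modules\<close>

lemma rhomD:
  assumes "f \<in> rhom R M N"
  shows "f \<in> hom M N" "f \<in> extensional (carrier M)"
    "\<And>x. x \<in> carrier M \<Longrightarrow> f x \<in> carrier N"
    "\<And>x y. x \<in> carrier M \<Longrightarrow> y \<in> carrier M \<Longrightarrow> f (x \<otimes>\<^bsub>M\<^esub> y) = f x \<otimes>\<^bsub>N\<^esub> f y"
    "\<And>x r. x \<in> carrier M \<Longrightarrow> r \<in> carrier R \<Longrightarrow> f (ract M x r) = ract N (f x) r"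
  using assms unfolding rhom_def hom_def by auto

lemma rhomI:
  assumes "f \<in> extensional (carrier M)"
    "\<And>x. x \<in> carrier M \<Longrightarrow> f x \<in> carrier N"
    "\<And>x y. x \<in> carrier M \<Longrightarrow> y \<in> carrier M \<Longrightarrow> f (x \<otimes>\<^bsub>M\<^esub> y) = f x \<otimes>\<^bsub>N\<^esub> f y"
    "\<And>x r. x \<in> carrier M \<Longrightarrow> r \<in> carrier R \<Longrightarrow> f (ract M x r) = ract N (f x) r"
  shows "f \<in> rhom R M N"
  using assms unfolding rhom_def hom_def by auto

lemma right_module_group: "right_module R M \<Longrightarrow> comm_group M" "right_module R M \<Longrightarrow> group M"
  by (simp_all add: right_module.comm_group_M comm_group.axioms)

lemma rhom_group_hom:
  "\<lbrakk>right_module R M; right_module R N; f \<in> rhom R M N\<rbrakk> \<Longrightarrow> group_hom M N f"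
  by (simp add: group_hom.intro group_hom_axioms.intro right_module_group rhomD(1))

lemma rhom_compose:
  assumes "right_module R A" "f \<in> rhom R A B" "g \<in> rhom R B C"
  shows "compose (carrier A) g f \<in> rhom R A C"
proof -
  interpret A: right_module R A by fact
  interpret comm_group A by (rule A.comm_group_M)
  show ?thesis
    by (rule rhomI) (auto simp: compose_def A.ract_closed rhomD[OF assms(2)] rhomD[OF assms(3)])
qed

lemma (in right_module) ract_hom:
  "r \<in> carrier R \<Longrightarrow> (\<lambda>x. ract M x r) \<in> hom M M"
  by (simp add: homI ract_closed ract_add_left)

lemma (in right_module) ract_group_hom:
  "r \<in> carrier R \<Longrightarrow> group_hom M M (\<lambda>x. ract M x r)"
  using ract_hom comm_group_M by (simp add: group_hom.intro group_hom_axioms.intro comm_group.axioms)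

section \<open>The regular module and homomorphisms out of it\<close>

lemma right_module_regular:
  assumes "ring R" shows "right_module R (regular_rmod R)"
proof -
  interpret ring R by fact
  have "comm_group (regular_rmod R)"
  proof (rule comm_groupI)
    fix x assume "x \<in> carrier (regular_rmod R)"
    then show "\<exists>y\<in>carrier (regular_rmod R). y \<otimes>\<^bsub>regular_rmod R\<^esub> x = \<one>\<^bsub>regular_rmod R\<^esub>"
      using l_neg by (force simp: regular_rmod_def)
  qed (auto simp: regular_rmod_def a_ac)
  then show ?thesis
    by (intro right_module.intro assms) (auto simp: regular_rmod_def l_distr r_distr m_assoc)
qed

text \<open>Needed so that \<open>modR R\<close> contains a copy of the ring. Evaluation at
  coordinate 0 is bijective on the free module of rank one, so the only relation is the zero
  element.\<close>

lemma fin_pres_regular: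
  assumes "ring R" shows "fin_pres R (regular_rmod R)"
proof -
  interpret ring R by fact
  let ?F = "free_rmod R 1" and ?p = "\<lambda>v\<in>carrier (free_rmod R 1). v (0::nat)"
  have p: "?p \<in> rhom R ?F (regular_rmod R)"
    using PiE_mem[of _ "{..<Suc 0}" "\<lambda>_. carrier R" 0]
    by (intro rhomI) (simp_all add: free_rmod_def regular_rmod_def Pi_iff)
  have surj: "?p ` carrier ?F = carrier (regular_rmod R)"
  proof -
    have "x \<in> ?p ` carrier ?F" if "x \<in> carrier R" for x
      using that by (intro image_eqI[of _ _ "\<lambda>i\<in>{..<1}. x"]) (auto simp: free_rmod_def)
    then show ?thesis by (auto simp: free_rmod_def regular_rmod_def)
  qed
  have ker: "kernel ?F (regular_rmod R) ?p = {\<one>\<^bsub>?F\<^esub>}"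
    unfolding kernel_def free_rmod_def regular_rmod_def
    by (auto simp: PiE_def intro!: extensionalityI[of _ "{..<Suc 0}"])
  \<comment> \<open>The free module of rank 0 has exactly one element, so this constant map already
    covers the zero kernel.\<close>
  let ?K = "?F\<lparr>carrier := {\<one>\<^bsub>?F\<^esub>}\<rparr>" and ?q = "\<lambda>v\<in>carrier (free_rmod R 0). \<one>\<^bsub>?F\<^esub>"
  have "?q \<in> rhom R (free_rmod R 0) ?K"
    by (rule rhomI) (auto simp: free_rmod_def fun_eq_iff)
  moreover have "?q ` carrier (free_rmod R 0) = carrier ?K"
    by (simp add: free_rmod_def)
  ultimately have "fin_gen R ?K" unfolding fin_gen_def by blast
  then show ?thesis
    unfolding fin_pres_def
    by (intro exI[of _ 1] bexI[of _ ?p] conjI p surj) (simp only: ker)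
qed

text \<open>This is projectivity of the ring: a homomorphism out of a free module on one generator
  lifts as soon as the image of the generator does.\<close>

lemma regular_lift:
  assumes A: "right_module R A" and M: "right_module R M" and N: "right_module R N"
    and iso: "rmod_iso R A (regular_rmod R)"
    and d: "d \<in> rhom R M N" and f: "f \<in> rhom R A N"
    and im: "f ` carrier A \<subseteq> d ` carrier M"
  shows "\<exists>h\<in>rhom R A M. compose (carrier A) d h = f"
proof -
  interpret A: right_module R A by fact
  interpret M: right_module R M by fact
  interpret R: ring R by (rule A.ring_R)
  obtain u where u: "u \<in> rhom R A (regular_rmod R)" and bij: "bij_betw u (carrier A) (carrier R)"
    using iso unfolding rmod_iso_def by (auto simp: regular_rmod_def)
  have u': "u a \<in> carrier R" "u (a \<otimes>\<^bsub>A\<^esub> b) = u a \<oplus>\<^bsub>R\<^esub> u b"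
    "r \<in> carrier R \<Longrightarrow> u (ract A a r) = u a \<otimes>\<^bsub>R\<^esub> r"
    if "a \<in> carrier A" "b \<in> carrier A" for a b r
    using rhomD(3-5)[OF u] that by (auto simp: regular_rmod_def)
  \<comment> \<open>\<open>e\<close> is the generator of \<open>A\<close> that corresponds to the
    unit of the ring; \<open>y\<close> will be a preimage under \<open>d\<close> of its
    image.\<close>
  obtain e where e: "e \<in> carrier A" "u e = \<one>\<^bsub>R\<^esub>"
    using bij R.one_closed unfolding bij_betw_def by (metis imageE)
  obtain y where y: "y \<in> carrier M" "d y = f e" using im e(1) by force
  let ?h = "\<lambda>a\<in>carrier A. ract M y (u a)"
  have h: "?h \<in> rhom R A M"
    using y(1) right_module_group(2)[OF A]
    by (intro rhomI) (auto simp: u' M.ract_closed M.ract_add_right M.ract_assoc A.ract_closed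
        group.is_monoid monoid.m_closed)
  \<comment> \<open>Both sides have the same image under the injective map \<open>u\<close>, because
    \<open>u e\<close> is the unit.\<close>
  have gen: "ract A e (u a) = a" if "a \<in> carrier A" for a
    using bij_betw_imp_inj_on[OF bij] that e
    by (auto intro!: inj_onD[of u "carrier A"] simp: u' A.ract_closed)
  have "d (ract M y (u a)) = f a" if a: "a \<in> carrier A" for a
    using y rhomD(5)[OF d y(1) u'(1)[OF a a]] rhomD(5)[OF f e(1) u'(1)[OF a a]] gen[OF a] by simp
  then have "compose (carrier A) d ?h = f"
    by (intro extensionalityI[OF _ rhomD(2)[OF f]]) (auto simp: compose_def)
  with h show ?thesis by blast
qed

text \<open>The homomorphism is \<open>u\<close> followed by the map sending a scalar
  \<open>r\<close> to \<open>x r\<close>. It takes the value \<open>x\<close> at the element that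
  \<open>u\<close> maps to the unit.\<close>

lemma regular_hom_onto:
  assumes A: "right_module R A" and M: "right_module R M"
    and iso: "rmod_iso R A (regular_rmod R)" and x: "x \<in> carrier M"
  obtains f a where "f \<in> rhom R A M" "a \<in> carrier A" "f a = x"
proof -
  interpret A: right_module R A by fact
  interpret M: right_module R M by fact
  interpret R: ring R by (rule A.ring_R)
  obtain u where u: "u \<in> rhom R A (regular_rmod R)" and bij: "bij_betw u (carrier A) (carrier R)"
    using iso unfolding rmod_iso_def by (auto simp: regular_rmod_def)
  have g: "(\<lambda>r\<in>carrier R. ract M x r) \<in> rhom R (regular_rmod R) M"
    using x by (intro rhomI) (auto simp: regular_rmod_def M.ract_closed M.ract_add_right M.ract_assoc)
  obtain e where e: "e \<in> carrier A" "u e = \<one>\<^bsub>R\<^esub>"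
    using bij R.one_closed unfolding bij_betw_def by (metis imageE)
  show thesis
    by (rule that[OF rhom_compose[OF A u g] e(1)]) (simp add: compose_def e M.ract_one x)
qed

subsection \<open>Quotients\<close>

text \<open>Well-definedness of the map induced by \<open>h\<close> on cosets. Both the action on
  \<open>rcoker\<close> and the arrows of a cokernel functor are given by such a union, which needs
  no choice of representatives; all cosets in the union coincide.\<close>

lemma UN_rcos_hom:
  assumes "subgroup H G" "subgroup K L" "comm_group G" "comm_group L" "h \<in> hom G L" "h ` H \<subseteq> K"
    and x: "x \<in> carrier G"
  shows "(\<Union>y\<in>H #>\<^bsub>G\<^esub> x. K #>\<^bsub>L\<^esub> h y) = K #>\<^bsub>L\<^esub> h x"
proof -
  interpret G: comm_group G by fact
  interpret L: comm_group L by fact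
  interpret H: subgroup H G by fact
  interpret K: subgroup K L by fact
  have hx: "h x \<in> carrier L" using assms(5) x by (auto simp: hom_def)
  have "K #>\<^bsub>L\<^esub> h y = K #>\<^bsub>L\<^esub> h x" if y: "y \<in> H #>\<^bsub>G\<^esub> x" for y
  proof -
    obtain z where z: "z \<in> H" "y = z \<otimes>\<^bsub>G\<^esub> x" using y by (auto simp: r_coset_def)
    then have "h y = h z \<otimes>\<^bsub>L\<^esub> h x" using assms(5) x H.subset by (auto simp: hom_def)
    moreover have "h z \<in> K" using z assms(6) by blast
    \<comment> \<open>The factor \<open>h z\<close> lies in \<open>K\<close> and is absorbed by the
      coset.\<close>
    ultimately show ?thesis
      using L.coset_mult_assoc[OF K.subset _ hx] K.rcos_const[OF L.is_group] K.subset by (metis subsetD)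
  qed
  moreover have "x \<in> H #>\<^bsub>G\<^esub> x" by (rule G.rcos_self[OF x assms(1)])
  ultimately show ?thesis by blast
qed

lemma rcos_eq_self_iff:
  assumes "group G" "subgroup H G" "x \<in> carrier G"
  shows "H #>\<^bsub>G\<^esub> x = H \<longleftrightarrow> x \<in> H"
  using assms by (metis group.coset_join1 group.coset_join2 subgroup.subset subgroup_def)

text \<open>Replaces cosets by a surjection onto the given copy \<open>N\<close> of the cokernel:
  the coset map of \<open>M\<close> is followed by the inverse of the isomorphism from
  \<open>N\<close>.\<close>

lemma rcoker_projection:
  assumes M: "right_module R M" and M': "right_module R M'" and N: "right_module R N"
    and d: "d \<in> rhom R M' M" and iso: "rmod_iso R N (rcoker M' M d)"
  obtains p where "p \<in> rhom R M N" "p ` carrier M = carrier N" "kernel M N p = d ` carrier M'"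
proof -
  interpret M: right_module R M by fact
  interpret N: right_module R N by fact
  interpret MG: comm_group M by (rule M.comm_group_M)
  interpret NG: comm_group N by (rule N.comm_group_M)
  interpret d: group_hom M' M d by (rule rhom_group_hom[OF M' M d])
  let ?D = "d ` carrier M'" and ?C = "rcoker M' M d"
  have D: "subgroup ?D M" by (rule d.img_is_subgroup)
  then interpret D: normal ?D M by (rule MG.subgroup_imp_normal)
  obtain g where g: "g \<in> rhom R N ?C" and bij: "bij_betw g (carrier N) (carrier ?C)"
    using iso unfolding rmod_iso_def by blast
  have C: "carrier ?C = (\<lambda>x. ?D #>\<^bsub>M\<^esub> x) ` carrier M"
    "\<And>x y. x \<in> carrier M \<Longrightarrow> y \<in> carrier M \<Longrightarrow>
      (?D #>\<^bsub>M\<^esub> x) \<otimes>\<^bsub>?C\<^esub> (?D #>\<^bsub>M\<^esub> y) = ?D #>\<^bsub>M\<^esub> (x \<otimes>\<^bsub>M\<^esub> y)"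
    "\<one>\<^bsub>?C\<^esub> = ?D"
    by (auto simp: rcoker_def FactGroup_def RCOSETS_def D.rcos_sum)
  have act: "ract ?C (?D #>\<^bsub>M\<^esub> x) r = ?D #>\<^bsub>M\<^esub> ract M x r"
    if "x \<in> carrier M" "r \<in> carrier R" for x r
  proof -
    \<comment> \<open>The image of \<open>d\<close> is stable under the action because
      \<open>d\<close> is linear, so the action descends to cosets.\<close>
    have "(\<lambda>x. ract M x r) ` ?D \<subseteq> ?D"
    proof safe
      fix y assume "y \<in> carrier M'"
      then show "ract M (d y) r \<in> ?D"
        using rhomD(5)[OF d _ that(2)] right_module.ract_closed[OF M' _ that(2)] by (metis imageI)
    qed
    from UN_rcos_hom[OF D D M.comm_group_M M.comm_group_M M.ract_hom[OF that(2)] this that(1)]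
    show ?thesis by (simp add: rcoker_def)
  qed
  let ?k = "inv_into (carrier N) g"
  define p where "p = (\<lambda>x\<in>carrier M. ?k (?D #>\<^bsub>M\<^esub> x))"
  have p: "p x \<in> carrier N" "g (p x) = ?D #>\<^bsub>M\<^esub> x" if "x \<in> carrier M" for x
  proof -
    have "?D #>\<^bsub>M\<^esub> x \<in> g ` carrier N" using bij that by (auto simp: bij_betw_def C)
    then show "p x \<in> carrier N" "g (p x) = ?D #>\<^bsub>M\<^esub> x"
      using that by (auto simp: p_def inv_into_into f_inv_into_f)
  qed
  \<comment> \<open>Equations in \<open>N\<close> are verified after applying the injective map
    \<open>g\<close>, where they become equations between cosets.\<close>
  have inj: "x = y" if "g x = g y" "x \<in> carrier N" "y \<in> carrier N" for x y
    using bij that by (auto simp: bij_betw_def inj_on_def)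
  have p_rhom: "p \<in> rhom R M N"
  proof (rule rhomI)
    show "p \<in> extensional (carrier M)" by (simp add: p_def)
    show "p (x \<otimes>\<^bsub>M\<^esub> y) = p x \<otimes>\<^bsub>N\<^esub> p y" if "x \<in> carrier M" "y \<in> carrier M" for x y
      using that by (intro inj) (simp_all add: p rhomD(4)[OF g] C)
    show "p (ract M x r) = ract N (p x) r" if "x \<in> carrier M" "r \<in> carrier R" for x r
      using that by (intro inj) (simp_all add: p rhomD(5)[OF g] act M.ract_closed N.ract_closed)
  qed (rule p(1))
  moreover have "p ` carrier M = carrier N"
  proof -
    have "y \<in> p ` carrier M" if y: "y \<in> carrier N" for y
    proof -
      obtain x where "x \<in> carrier M" "g y = ?D #>\<^bsub>M\<^esub> x" using rhomD(3)[OF g y] by (auto simp: C)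
      then show ?thesis using inj[of y "p x"] y p by auto
    qed
    then show ?thesis using p by auto
  qed
  moreover have "kernel M N p = ?D"
  proof -
    \<comment> \<open>The value of \<open>g\<close> at the neutral element is computed through
      \<open>p\<close>, a homomorphism between the groups \<open>M\<close> and \<open>N\<close>. In
      this way no group structure on \<open>rcoker\<close> has to be established.\<close>
    have "g \<one>\<^bsub>N\<^esub> = ?D"
    proof -
      have "p \<one>\<^bsub>M\<^esub> = \<one>\<^bsub>N\<^esub>" by (rule hom_one[OF rhomD(1)[OF p_rhom]]) unfold_locales
      then show ?thesis using p(2)[OF MG.one_closed] MG.coset_mult_one[OF D.subset] by simp
    qed
    then have "p x = \<one>\<^bsub>N\<^esub> \<longleftrightarrow> x \<in> ?D" if "x \<in> carrier M" for x
      using p[OF that] inj[of "p x" "\<one>\<^bsub>N\<^esub>"] rcos_eq_self_iff[OF MG.is_group D that] by auto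
    then show ?thesis using D.subset by (auto simp: kernel_def)
  qed
  ultimately show thesis by (rule that)
qed

subsection \<open>The functor category\<close>

lemma Mod_modRD:
  assumes "F \<in> Mod_modR R"
  shows "\<And>A. A \<in> modR R \<Longrightarrow> comm_group (Obj F A)"
    "\<And>A B f. \<lbrakk>A \<in> modR R; B \<in> modR R; f \<in> rhom R A B\<rbrakk> \<Longrightarrow> Arr F A B f \<in> hom (Obj F B) (Obj F A)"
    "\<And>A x. \<lbrakk>A \<in> modR R; x \<in> carrier (Obj F A)\<rbrakk> \<Longrightarrow> Arr F A A (\<lambda>a\<in>carrier A. a) x = x"
    "\<And>A B C f g x. \<lbrakk>A \<in> modR R; B \<in> modR R; C \<in> modR R; f \<in> rhom R A B; g \<in> rhom R B C;
      x \<in> carrier (Obj F C)\<rbrakk> \<Longrightarrow> Arr F A C (compose (carrier A) g f) x = Arr F A B f (Arr F B C g x)"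
    "\<And>A B f g x. \<lbrakk>A \<in> modR R; B \<in> modR R; f \<in> rhom R A B; g \<in> rhom R A B; x \<in> carrier (Obj F B)\<rbrakk>
      \<Longrightarrow> Arr F A B (f \<otimes>\<^bsub>hom_grp R A B\<^esub> g) x = Arr F A B f x \<otimes>\<^bsub>Obj F A\<^esub> Arr F A B g x"
  using assms unfolding Mod_modR_def by blast+

lemma Mod_modRI:
  assumes "\<And>A. A \<in> modR R \<Longrightarrow> comm_group (Obj F A)"
    "\<And>A B f. \<lbrakk>A \<in> modR R; B \<in> modR R; f \<in> rhom R A B\<rbrakk> \<Longrightarrow> Arr F A B f \<in> hom (Obj F B) (Obj F A)"
    "\<And>A x. \<lbrakk>A \<in> modR R; x \<in> carrier (Obj F A)\<rbrakk> \<Longrightarrow> Arr F A A (\<lambda>a\<in>carrier A. a) x = x"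
    "\<And>A B C f g x. \<lbrakk>A \<in> modR R; B \<in> modR R; C \<in> modR R; f \<in> rhom R A B; g \<in> rhom R B C;
      x \<in> carrier (Obj F C)\<rbrakk> \<Longrightarrow> Arr F A C (compose (carrier A) g f) x = Arr F A B f (Arr F B C g x)"
    "\<And>A B f g x. \<lbrakk>A \<in> modR R; B \<in> modR R; f \<in> rhom R A B; g \<in> rhom R A B; x \<in> carrier (Obj F B)\<rbrakk>
      \<Longrightarrow> Arr F A B (f \<otimes>\<^bsub>hom_grp R A B\<^esub> g) x = Arr F A B f x \<otimes>\<^bsub>Obj F A\<^esub> Arr F A B g x"
  shows "F \<in> Mod_modR R"
  using assms unfolding Mod_modR_def by blast

lemma modRD: "A \<in> modR R \<Longrightarrow> right_module R A"
  by (simp add: modR_def)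

lemma nat_transD:
  assumes "nat_trans R F G \<eta>"
  shows "\<And>A. A \<in> modR R \<Longrightarrow> \<eta> A \<in> hom (Obj F A) (Obj G A)"
    "\<And>A B f x. \<lbrakk>A \<in> modR R; B \<in> modR R; f \<in> rhom R A B; x \<in> carrier (Obj F B)\<rbrakk> \<Longrightarrow>
      \<eta> A (Arr F A B f x) = Arr G A B f (\<eta> B x)"
  using assms unfolding nat_trans_def by blast+

lemma nat_trans_group_hom:
  "\<lbrakk>F \<in> Mod_modR R; G \<in> Mod_modR R; nat_trans R F G \<eta>; A \<in> modR R\<rbrakk> \<Longrightarrow>
    group_hom (Obj F A) (Obj G A) (\<eta> A)"
  by (simp add: group_hom.intro group_hom_axioms.intro Mod_modRD(1) comm_group.axioms nat_transD(1))

lemma Arr_group_hom: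
  "\<lbrakk>F \<in> Mod_modR R; A \<in> modR R; B \<in> modR R; f \<in> rhom R A B\<rbrakk> \<Longrightarrow>
    group_hom (Obj F B) (Obj F A) (Arr F A B f)"
  by (simp add: group_hom.intro group_hom_axioms.intro Mod_modRD comm_group.axioms)

section \<open>Hom functors and kernels of natural transformations\<close>

lemma comm_group_hom_grp:
  assumes A: "right_module R A" and M: "right_module R M"
  shows "comm_group (hom_grp R A M)"
proof -
  interpret A: right_module R A by fact
  interpret M: right_module R M by fact
  interpret AG: comm_group A by (rule A.comm_group_M)
  interpret MG: comm_group M by (rule M.comm_group_M)
  have sel: "carrier (hom_grp R A M) = rhom R A M"
    "\<And>f g. f \<otimes>\<^bsub>hom_grp R A M\<^esub> g = (\<lambda>x\<in>carrier A. f x \<otimes>\<^bsub>M\<^esub> g x)"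
    "\<one>\<^bsub>hom_grp R A M\<^esub> = (\<lambda>x\<in>carrier A. \<one>\<^bsub>M\<^esub>)"
    by (simp_all add: hom_grp_def)
  have act1: "ract M \<one>\<^bsub>M\<^esub> r = \<one>\<^bsub>M\<^esub>" if "r \<in> carrier R" for r
    by (rule group_hom.hom_one[OF M.ract_group_hom[OF that]])
  have act_inv: "ract M (inv\<^bsub>M\<^esub> x) r = inv\<^bsub>M\<^esub> (ract M x r)"
    if "r \<in> carrier R" "x \<in> carrier M" for r x
    by (rule group_hom.hom_inv[OF M.ract_group_hom[OF that(1)] that(2)])
  note rh = rhomD(3-5)[of _ R A M]
  show ?thesis
  proof (rule comm_groupI; unfold sel)
    fix f g assume f: "f \<in> rhom R A M" and g: "g \<in> rhom R A M"
    \<comment> \<open>Additivity of the pointwise sum exchanges the two middle summands, by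
      commutativity of \<open>M\<close>.\<close>
    show "(\<lambda>x\<in>carrier A. f x \<otimes>\<^bsub>M\<^esub> g x) \<in> rhom R A M"
      by (rule rhomI) (auto simp: rh[OF f] rh[OF g] A.ract_closed M.ract_add_left MG.m_ac)
    show "(\<lambda>x\<in>carrier A. f x \<otimes>\<^bsub>M\<^esub> g x) = (\<lambda>x\<in>carrier A. g x \<otimes>\<^bsub>M\<^esub> f x)"
      by (rule restrict_ext) (simp add: rh[OF f] rh[OF g] MG.m_comm)
    fix h assume h: "h \<in> rhom R A M"
    show "(\<lambda>x\<in>carrier A. (\<lambda>x\<in>carrier A. f x \<otimes>\<^bsub>M\<^esub> g x) x \<otimes>\<^bsub>M\<^esub> h x)
        = (\<lambda>x\<in>carrier A. f x \<otimes>\<^bsub>M\<^esub> (\<lambda>x\<in>carrier A. g x \<otimes>\<^bsub>M\<^esub> h x) x)"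
      by (rule restrict_ext) (simp add: rh[OF f] rh[OF g] rh[OF h] MG.m_assoc)
  next
    show "(\<lambda>x\<in>carrier A. \<one>\<^bsub>M\<^esub>) \<in> rhom R A M"
      by (rule rhomI) (auto simp: A.ract_closed act1)
  next
    fix f assume f: "f \<in> rhom R A M"
    show "(\<lambda>x\<in>carrier A. (\<lambda>x\<in>carrier A. \<one>\<^bsub>M\<^esub>) x \<otimes>\<^bsub>M\<^esub> f x) = f"
      by (rule extensionalityI[OF _ rhomD(2)[OF f]]) (auto simp: rh[OF f])
    have "(\<lambda>x\<in>carrier A. inv\<^bsub>M\<^esub> (f x)) \<in> rhom R A M"
      by (rule rhomI) (auto simp: rh[OF f] A.ract_closed act_inv MG.inv_mult)
    moreover have "(\<lambda>x\<in>carrier A. (\<lambda>x\<in>carrier A. inv\<^bsub>M\<^esub> (f x)) x \<otimes>\<^bsub>M\<^esub> f x)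
        = (\<lambda>x\<in>carrier A. \<one>\<^bsub>M\<^esub>)"
      by (rule restrict_ext) (simp add: rh[OF f])
    ultimately show "\<exists>g\<in>rhom R A M. (\<lambda>x\<in>carrier A. g x \<otimes>\<^bsub>M\<^esub> f x) = (\<lambda>x\<in>carrier A. \<one>\<^bsub>M\<^esub>)"
      by blast
  qed
qed

lemma homF_Mod_modR:
  assumes M: "right_module R M"
  shows "homF R M \<in> Mod_modR R"
proof (rule Mod_modRI)
  fix A assume A: "A \<in> modR R"
  show "comm_group (Obj (homF R M) A)"
    using comm_group_hom_grp[OF modRD[OF A] M] by (simp add: homF_def)
  show "Arr (homF R M) A A (\<lambda>a\<in>carrier A. a) x = x" if "x \<in> carrier (Obj (homF R M) A)" for x
    using that rhomD(2)[of x R A M]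
    by (intro extensionalityI[of _ "carrier A"]) (auto simp: homF_def hom_grp_def compose_def)
  fix B f assume B: "B \<in> modR R" and f: "f \<in> rhom R A B"
  show "Arr (homF R M) A B f \<in> hom (Obj (homF R M) B) (Obj (homF R M) A)"
    using rhom_compose[OF modRD[OF A] f, of _ M]
    by (intro homI) (auto simp: homF_def hom_grp_def compose_def rhomD[OF f])
  show "Arr (homF R M) A B (f \<otimes>\<^bsub>hom_grp R A B\<^esub> g) x
      = Arr (homF R M) A B f x \<otimes>\<^bsub>Obj (homF R M) A\<^esub> Arr (homF R M) A B g x"
    if g: "g \<in> rhom R A B" and x: "x \<in> carrier (Obj (homF R M) B)" for g x
    using x by (auto simp: homF_def hom_grp_def compose_def rhomD[OF f] rhomD[OF g] rhomD(4)
        intro!: restrict_ext)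
  fix C g x assume C: "C \<in> modR R" and g: "g \<in> rhom R B C" and x: "x \<in> carrier (Obj (homF R M) C)"
  show "Arr (homF R M) A C (compose (carrier A) g f) x
      = Arr (homF R M) A B f (Arr (homF R M) B C g x)"
    by (auto simp: homF_def compose_def rhomD[OF f])
qed

lemma homF_simps [simp]:
  "carrier (Obj (homF R M) A) = rhom R A M"
  "Arr (homF R M) A B f g = compose (carrier A) g f"
  "\<one>\<^bsub>Obj (homF R M) A\<^esub> = (\<lambda>x\<in>carrier A. \<one>\<^bsub>M\<^esub>)"
  "g \<otimes>\<^bsub>Obj (homF R M) A\<^esub> h = (\<lambda>x\<in>carrier A. g x \<otimes>\<^bsub>M\<^esub> h x)"
  by (simp_all add: homF_def hom_grp_def)

lemma homF_map_nat_trans: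
  assumes d: "d \<in> rhom R M N"
  shows "nat_trans R (homF R M) (homF R N) (homF_map d)"
  unfolding nat_trans_def
proof (intro conjI ballI)
  show "homF_map d A \<in> hom (Obj (homF R M) A) (Obj (homF R N) A)" if "A \<in> modR R" for A
    using rhom_compose[OF modRD[OF that] _ d]
    by (intro homI) (auto simp: homF_map_def compose_def rhomD[OF d] rhomD(3) intro!: restrict_ext)
  show "homF_map d A (Arr (homF R M) A B f x) = Arr (homF R N) A B f (homF_map d B x)"
    if "f \<in> rhom R A B" for A B f x
    using that by (auto simp: homF_map_def compose_def rhomD)
qed

lemma ker_fun_Mod_modR:
  assumes F: "F \<in> Mod_modR R" and G: "G \<in> Mod_modR R" and \<eta>: "nat_trans R F G \<eta>"
  shows "ker_fun F G \<eta> \<in> Mod_modR R"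
proof -
  have sel: "Obj (ker_fun F G \<eta>) A = (Obj F A)\<lparr>carrier := kernel (Obj F A) (Obj G A) (\<eta> A)\<rparr>"
    "Arr (ker_fun F G \<eta>) = Arr F" for A
    by (simp_all add: ker_fun_def)
  show ?thesis
  proof (rule Mod_modRI; unfold sel)
    fix A assume A: "A \<in> modR R"
    interpret h: group_hom "Obj F A" "Obj G A" "\<eta> A" by (rule nat_trans_group_hom[OF F G \<eta> A])
    interpret FA: comm_group "Obj F A" by (rule Mod_modRD(1)[OF F A])
    show "comm_group ((Obj F A)\<lparr>carrier := kernel (Obj F A) (Obj G A) (\<eta> A)\<rparr>)"
      by (rule group.group_comm_groupI[OF subgroup.subgroup_is_group[OF h.subgroup_kernel]])
        (auto simp: kernel_def FA.m_comm)
    fix B f assume B: "B \<in> modR R" and f: "f \<in> rhom R A B"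
    interpret k: group_hom "Obj F B" "Obj F A" "Arr F A B f" by (rule Arr_group_hom[OF F A B f])
    interpret l: group_hom "Obj G B" "Obj G A" "Arr G A B f" by (rule Arr_group_hom[OF G A B f])
    \<comment> \<open>By naturality, \<open>\<eta> A\<close> sends the image of a kernel element
      under \<open>Arr F A B f\<close> to the image of the neutral element under
      \<open>Arr G A B f\<close>, which is again neutral.\<close>
    show "Arr F A B f \<in> hom ((Obj F B)\<lparr>carrier := kernel (Obj F B) (Obj G B) (\<eta> B)\<rparr>)
        ((Obj F A)\<lparr>carrier := kernel (Obj F A) (Obj G A) (\<eta> A)\<rparr>)"
      by (rule homI) (auto simp: kernel_def nat_transD(2)[OF \<eta> A B f])
  qed (auto simp: kernel_def Mod_modRD[OF F])
qed

lemma ker_fun_inclusion: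
  "nat_trans R (ker_fun F G \<eta>) F (\<lambda>A x. x)"
  "ntr_mono R (ker_fun F G \<eta>) (\<lambda>A x. x)"
  "ntr_exact R (ker_fun F G \<eta>) (\<lambda>A x. x) F \<eta> G"
  unfolding nat_trans_def ntr_mono_def ntr_exact_def
  by (auto simp: ker_fun_def kernel_def hom_def)

section \<open>Cokernels of natural transformations\<close>

definition coker_fun :: "('r, 'b) mfunctor \<Rightarrow> ('r, 'c) mfunctor \<Rightarrow> ('r, 'b, 'c) mtrans
    \<Rightarrow> ('r, 'c set) mfunctor" where
  "coker_fun F G \<eta> = \<lparr>Obj = (\<lambda>A. Obj G A Mod (\<eta> A ` carrier (Obj F A))),
     Arr = (\<lambda>A B f C. \<Union>y\<in>C. (\<eta> A ` carrier (Obj F A)) #>\<^bsub>Obj G A\<^esub> Arr G A B f y)\<rparr>"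

definition coker_proj :: "('r, 'b) mfunctor \<Rightarrow> ('r, 'c) mfunctor \<Rightarrow> ('r, 'b, 'c) mtrans
    \<Rightarrow> ('r, 'c, 'c set) mtrans" where
  "coker_proj F G \<eta> = (\<lambda>A y. (\<eta> A ` carrier (Obj F A)) #>\<^bsub>Obj G A\<^esub> y)"

locale functor_coker =
  fixes R :: "'r ring" and F :: "('r, 'b) mfunctor" and G :: "('r, 'c) mfunctor"
    and \<eta> :: "('r, 'b, 'c) mtrans"
  assumes F: "F \<in> Mod_modR R" and G: "G \<in> Mod_modR R" and \<eta>: "nat_trans R F G \<eta>"
begin

abbreviation "im A \<equiv> \<eta> A ` carrier (Obj F A)"
abbreviation "C \<equiv> coker_fun F G \<eta>"
abbreviation "\<pi> \<equiv> coker_proj F G \<eta>"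

lemma im_normal: "A \<in> modR R \<Longrightarrow> im A \<lhd> Obj G A"
  using group_hom.img_is_subgroup[OF nat_trans_group_hom[OF F G \<eta>]]
  by (simp add: comm_group.subgroup_imp_normal Mod_modRD(1)[OF G])

lemma im_subgroup: "A \<in> modR R \<Longrightarrow> subgroup (im A) (Obj G A)"
  by (rule group_hom.img_is_subgroup[OF nat_trans_group_hom[OF F G \<eta>]])

lemma carrier_C: "carrier (Obj C A) = \<pi> A ` carrier (Obj G A)"
  by (auto simp: coker_fun_def coker_proj_def FactGroup_def RCOSETS_def)

lemma one_C: "\<one>\<^bsub>Obj C A\<^esub> = im A"
  by (simp add: coker_fun_def FactGroup_def)

lemma mult_C:
  assumes "A \<in> modR R" "x \<in> carrier (Obj G A)" "y \<in> carrier (Obj G A)"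
  shows "\<pi> A x \<otimes>\<^bsub>Obj C A\<^esub> \<pi> A y = \<pi> A (x \<otimes>\<^bsub>Obj G A\<^esub> y)"
  using normal.rcos_sum[OF im_normal] assms by (simp add: coker_fun_def coker_proj_def FactGroup_def)

text \<open>By naturality \<open>Arr G A B f\<close> maps \<open>im B\<close> into
  \<open>im A\<close>, so the union defining the arrow collapses to a single coset by
  \<open>UN_rcos_hom\<close>. From here on arrows of \<open>C\<close> are computed on
  representatives.\<close>

lemma Arr_C:
  assumes A: "A \<in> modR R" and B: "B \<in> modR R" and f: "f \<in> rhom R A B"
    and y: "y \<in> carrier (Obj G B)"
  shows "Arr C A B f (\<pi> B y) = \<pi> A (Arr G A B f y)"
proof -
  interpret k: group_hom "Obj F B" "Obj F A" "Arr F A B f" by (rule Arr_group_hom[OF F A B f])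
  have "Arr G A B f ` im B \<subseteq> im A"
  proof safe
    fix x assume "x \<in> carrier (Obj F B)"
    then show "Arr G A B f (\<eta> B x) \<in> im A"
      using nat_transD(2)[OF \<eta> A B f] k.hom_closed by (metis imageI)
  qed
  from UN_rcos_hom[OF im_subgroup[OF B] im_subgroup[OF A] Mod_modRD(1)[OF G B]
      Mod_modRD(1)[OF G A] Mod_modRD(2)[OF G A B f] this y]
  show ?thesis by (simp add: coker_fun_def coker_proj_def)
qed

lemma Arr_G_closed:
  "\<lbrakk>A \<in> modR R; B \<in> modR R; f \<in> rhom R A B; y \<in> carrier (Obj G B)\<rbrakk>
    \<Longrightarrow> Arr G A B f y \<in> carrier (Obj G A)"
  by (rule group_hom.hom_closed[OF Arr_group_hom[OF G]])

text \<open>Every element of \<open>C\<close> at an object is the projection of an element of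
  \<open>G\<close>, and the projection commutes with sums and arrows; each law is thus inherited
  from \<open>G\<close>.\<close>

lemma C_Mod_modR: "C \<in> Mod_modR R"
proof (rule Mod_modRI)
  fix A assume A: "A \<in> modR R"
  interpret GA: comm_group "Obj G A" by (rule Mod_modRD(1)[OF G A])
  show "comm_group (Obj C A)"
    using GA.abelian_FactGroup[OF im_subgroup[OF A]] by (simp add: coker_fun_def)
  show "Arr C A A (\<lambda>a\<in>carrier A. a) x = x" if "x \<in> carrier (Obj C A)" for x
  proof -
    \<comment> \<open>\<open>Arr_C\<close> applies only to homomorphisms, so the identity has to be
      recognised as one; the same is done for the sum of \<open>f\<close> and \<open>g\<close>
      below.\<close>
    have "(\<lambda>a\<in>carrier A. a) \<in> rhom R A A"
      using right_module.ract_closed[OF modRD[OF A]]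
        monoid.m_closed[OF group.is_monoid[OF right_module_group(2)[OF modRD[OF A]]]]
      by (intro rhomI) auto
    then show ?thesis
      using that A by (auto simp: carrier_C Arr_C Mod_modRD(3)[OF G])
  qed
  fix B f assume B: "B \<in> modR R" and f: "f \<in> rhom R A B"
  interpret GB: comm_group "Obj G B" by (rule Mod_modRD(1)[OF G B])
  interpret l: group_hom "Obj G B" "Obj G A" "Arr G A B f" by (rule Arr_group_hom[OF G A B f])
  show "Arr C A B f \<in> hom (Obj C B) (Obj C A)"
    by (rule homI) (auto simp: carrier_C Arr_C A B f mult_C)
  show "Arr C A B (f \<otimes>\<^bsub>hom_grp R A B\<^esub> g) x = Arr C A B f x \<otimes>\<^bsub>Obj C A\<^esub> Arr C A B g x"
    if g: "g \<in> rhom R A B" and x: "x \<in> carrier (Obj C B)" for g x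
  proof -
    have "f \<otimes>\<^bsub>hom_grp R A B\<^esub> g \<in> rhom R A B"
      using monoid.m_closed[OF group.is_monoid[OF comm_group.axioms(2)
            [OF comm_group_hom_grp[OF modRD[OF A] modRD[OF B]]]], of f g] f g
      by (simp add: hom_grp_def)
    then show ?thesis
      using x by (auto simp: carrier_C Arr_C A B f g mult_C Mod_modRD(5)[OF G A B f g] Arr_G_closed)
  qed
  fix D g x assume D: "D \<in> modR R" and g: "g \<in> rhom R B D" and x: "x \<in> carrier (Obj C D)"
  show "Arr C A D (compose (carrier A) g f) x = Arr C A B f (Arr C B D g x)"
    using x by (auto simp: carrier_C Arr_C A B D f g rhom_compose[OF modRD[OF A] f g] Arr_G_closed
        Mod_modRD(4)[OF G A B D f g])
qed

lemma proj_nat_trans: "nat_trans R G C \<pi>"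
  unfolding nat_trans_def by (auto simp: homI carrier_C mult_C Arr_C)

lemma proj_epi: "ntr_epi R G C \<pi>"
  by (simp add: ntr_epi_def carrier_C)

lemma proj_exact: "ntr_exact R F \<eta> G \<pi> C"
  unfolding ntr_exact_def
proof (intro ballI)
  fix A assume A: "A \<in> modR R"
  interpret GA: comm_group "Obj G A" by (rule Mod_modRD(1)[OF G A])
  show "im A = kernel (Obj G A) (Obj C A) (\<pi> A)"
    using subgroup.subset[OF im_subgroup[OF A]] rcos_eq_self_iff[OF GA.is_group im_subgroup[OF A]]
    unfolding kernel_def one_C coker_proj_def by blast
qed

lemma zero_C:
  assumes A: "A \<in> modR R" and sub: "carrier (Obj G A) \<subseteq> im A"
  shows "zero_grp (Obj C A)"
proof -
  interpret GA: comm_group "Obj G A" by (rule Mod_modRD(1)[OF G A])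
  have "\<pi> A y = im A" if "y \<in> carrier (Obj G A)" for y
    using rcos_eq_self_iff[OF GA.is_group im_subgroup[OF A] that] sub that
    by (auto simp: coker_proj_def)
  then show ?thesis
    unfolding zero_grp_def carrier_C one_C using GA.one_closed by blast
qed

end

text \<open>The universal property of a quotient. The value at \<open>x\<close> is computed from a
  chosen preimage under \<open>\<epsilon>\<close>; two preimages differ by an element of the kernel
  of \<open>\<epsilon>\<close>, which \<open>\<phi>\<close> kills, so the choice does not matter.
  Additivity and naturality are then checked on elements of the form
  \<open>\<epsilon> A g\<close>.\<close>

lemma factor_through_epi:
  assumes F: "F \<in> Mod_modR R" and G: "G \<in> Mod_modR R" and H: "H \<in> Mod_modR R"
    and \<epsilon>: "nat_trans R G F \<epsilon>" and epi: "ntr_epi R G F \<epsilon>" and \<phi>: "nat_trans R G H \<phi>"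
    and ker: "\<And>A. A \<in> modR R \<Longrightarrow> kernel (Obj G A) (Obj F A) (\<epsilon> A) \<subseteq> kernel (Obj G A) (Obj H A) (\<phi> A)"
  shows "\<exists>\<eta>. nat_trans R F H \<eta> \<and> (\<forall>A\<in>modR R. \<forall>g\<in>carrier (Obj G A). \<eta> A (\<epsilon> A g) = \<phi> A g)"
proof -
  define \<eta> where "\<eta> = (\<lambda>A x. \<phi> A (inv_into (carrier (Obj G A)) (\<epsilon> A) x))"
  have \<eta>: "\<eta> A (\<epsilon> A g) = \<phi> A g" if A: "A \<in> modR R" and g: "g \<in> carrier (Obj G A)" for A g
  proof -
    interpret e: group_hom "Obj G A" "Obj F A" "\<epsilon> A" by (rule nat_trans_group_hom[OF G F \<epsilon> A])
    interpret h: group_hom "Obj G A" "Obj H A" "\<phi> A" by (rule nat_trans_group_hom[OF G H \<phi> A])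
    let ?g = "inv_into (carrier (Obj G A)) (\<epsilon> A) (\<epsilon> A g)"
    have g': "?g \<in> carrier (Obj G A)" "\<epsilon> A ?g = \<epsilon> A g"
      using g by (auto simp: inv_into_into f_inv_into_f)
    \<comment> \<open>The chosen preimage and \<open>g\<close> have the same image under
      \<open>\<epsilon> A\<close>, so their quotient lies in its kernel.\<close>
    have "?g \<otimes>\<^bsub>Obj G A\<^esub> inv\<^bsub>Obj G A\<^esub> g \<in> kernel (Obj G A) (Obj H A) (\<phi> A)"
      by (rule subsetD[OF ker[OF A]]) (simp add: kernel_def g g')
    then have "\<phi> A ?g \<otimes>\<^bsub>Obj H A\<^esub> inv\<^bsub>Obj H A\<^esub> \<phi> A g = \<one>\<^bsub>Obj H A\<^esub>"
      using g g'(1) by (simp add: kernel_def)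
    then have "\<phi> A ?g = \<phi> A g"
      using h.H.inv_solve_right[of "\<one>\<^bsub>Obj H A\<^esub>" "\<phi> A ?g" "\<phi> A g"] g g'(1) by simp
    then show ?thesis by (simp only: \<eta>_def)
  qed
  have surj: "\<exists>g\<in>carrier (Obj G A). x = \<epsilon> A g" if "A \<in> modR R" "x \<in> carrier (Obj F A)" for A x
    using epi that unfolding ntr_epi_def by blast
  have "nat_trans R F H \<eta>"
    unfolding nat_trans_def
  proof (intro conjI ballI)
    fix A assume A: "A \<in> modR R"
    interpret e: group_hom "Obj G A" "Obj F A" "\<epsilon> A" by (rule nat_trans_group_hom[OF G F \<epsilon> A])
    interpret h: group_hom "Obj G A" "Obj H A" "\<phi> A" by (rule nat_trans_group_hom[OF G H \<phi> A])
    show "\<eta> A \<in> hom (Obj F A) (Obj H A)"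
    proof (rule homI)
      show "\<eta> A x \<in> carrier (Obj H A)" if "x \<in> carrier (Obj F A)" for x
        using surj[OF A that] by (auto simp: \<eta>[OF A])
      fix x y assume "x \<in> carrier (Obj F A)" "y \<in> carrier (Obj F A)"
      then obtain g g' where g: "g \<in> carrier (Obj G A)" "x = \<epsilon> A g"
        and g': "g' \<in> carrier (Obj G A)" "y = \<epsilon> A g'" using surj[OF A] by metis
      then show "\<eta> A (x \<otimes>\<^bsub>Obj F A\<^esub> y) = \<eta> A x \<otimes>\<^bsub>Obj H A\<^esub> \<eta> A y"
        using \<eta>[OF A e.G.m_closed[OF g(1) g'(1)]] by (simp add: \<eta>[OF A])
    qed
    fix B f x assume B: "B \<in> modR R" and f: "f \<in> rhom R A B" and x: "x \<in> carrier (Obj F B)"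
    interpret l: group_hom "Obj G B" "Obj G A" "Arr G A B f" by (rule Arr_group_hom[OF G A B f])
    obtain g where g: "g \<in> carrier (Obj G B)" "x = \<epsilon> B g" using surj[OF B x] by blast
    then show "\<eta> A (Arr F A B f x) = Arr H A B f (\<eta> B x)"
      using \<eta>[OF A l.hom_closed[OF g(1)]] nat_transD(2)[OF \<epsilon> A B f g(1)] nat_transD(2)[OF \<phi> A B f g(1)]
      by (simp add: \<eta>[OF B])
  qed
  with \<eta> show ?thesis by blast
qed

subsection \<open>Functors vanishing at the ring\<close>

text \<open>An element of \<open>M0\<close> is a value of some homomorphism from the copy
  \<open>A\<close> of the ring. As \<open>F\<close> vanishes at \<open>A\<close>,
  \<open>\<epsilon>\<close> kills this homomorphism, which by exactness factors through
  \<open>d1\<close>. Hence \<open>d1\<close> is onto and its cokernel is zero.\<close>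

lemma is_nu_zero:
  fixes N :: "('r, 'm) rmod" and F :: "('r, 'b) mfunctor"
  assumes nu: "is_nu R F N" and A: "A \<in> modR R" and iso: "rmod_iso R A (regular_rmod R)"
    and zero: "zero_grp (Obj F A)"
  shows "zero_grp N"
proof -
  obtain M2 M1 M0 :: "('r, 'm) rmod" and d2 d1 \<epsilon> where res: "special_flat_resolution R M2 d2 M1 d1 M0 \<epsilon> F"
    and coker: "rmod_iso R N (rcoker M1 M0 d1)" and N: "right_module R N"
    using nu unfolding is_nu_def by blast
  have M1: "right_module R M1" and M0: "right_module R M0" and d1: "d1 \<in> rhom R M1 M0"
    and \<epsilon>: "nat_trans R (homF R M0) F \<epsilon>"
    and ex: "ntr_exact R (homF R M1) (homF_map d1) (homF R M0) \<epsilon> F"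
    using res unfolding special_flat_resolution_def by blast+
  obtain p where p: "p ` carrier M0 = carrier N" "kernel M0 N p = d1 ` carrier M1"
    using rcoker_projection[OF M0 M1 N d1 coker] by metis
  have "x \<in> d1 ` carrier M1" if x: "x \<in> carrier M0" for x
  proof -
    obtain f a where f: "f \<in> rhom R A M0" "a \<in> carrier A" "f a = x"
      by (rule regular_hom_onto[OF modRD[OF A] M0 iso x])
    have "\<epsilon> A f \<in> carrier (Obj F A)"
      using nat_transD(1)[OF \<epsilon> A] f(1) by (auto simp: hom_def)
    then have "f \<in> kernel (Obj (homF R M0) A) (Obj F A) (\<epsilon> A)"
      using zero f(1) by (simp add: kernel_def zero_grp_def)
    then have "f \<in> homF_map d1 A ` rhom R A M1"
      using ex A unfolding ntr_exact_def by simp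
    then obtain h where "h \<in> rhom R A M1" "f = compose (carrier A) d1 h"
      by (auto simp: homF_map_def)
    then show ?thesis using f rhomD(3)[of h R A M1 a] by (auto simp: compose_def)
  qed
  \<comment> \<open>\<open>p\<close> kills all of \<open>M0\<close> and is onto \<open>N\<close>, so
    \<open>N\<close> is zero.\<close>
  then have "\<And>x. x \<in> carrier M0 \<Longrightarrow> p x = \<one>\<^bsub>N\<^esub>" using p(2) by (auto simp: kernel_def)
  moreover have "\<one>\<^bsub>N\<^esub> \<in> carrier N"
    using right_module_group(2)[OF N] by (simp add: group.is_monoid monoid.one_closed)
  ultimately show ?thesis unfolding zero_grp_def p(1)[symmetric] by blast
qed

text \<open>Vanishing at the copies of the ring forces the clause on \<open>is_nu\<close> by
  \<open>is_nu_zero\<close>; this uses that \<open>modR R\<close> really contains such a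
  copy.\<close>

lemma Mod0_modRI:
  assumes "ring R" "F \<in> Mod_modR R"
    and zero: "\<And>A. \<lbrakk>A \<in> modR R; rmod_iso R A (regular_rmod R)\<rbrakk> \<Longrightarrow> zero_grp (Obj F A)"
  shows "F \<in> Mod0_modR R TYPE('m)"
proof -
  obtain A where "A \<in> modR R" "rmod_iso R A (regular_rmod R)"
    using modR_essentially_all[OF right_module_regular fin_pres_regular] assms(1) by blast
  then show ?thesis
    using assms is_nu_zero unfolding Mod0_modR_def by blast
qed

section \<open>The four-term exact sequence and the vanishing of its ends\<close>

theorem proposition3p1p5:
  fixes R :: "'r ring" and F :: "('r, 'b) mfunctor" and nuF :: "('r, 'm) rmod"
  assumes "right_coherent R"
    and "F \<in> Mod_modR R"
    and "is_nu R F nuF"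
  shows "\<exists>(F0 :: ('r, 'b) mfunctor) (F1 :: ('r, ('r fpelt \<Rightarrow> 'm) set) mfunctor) \<iota> \<eta> \<rho>.
    F0 \<in> Mod0_modR R TYPE('m) \<and> F1 \<in> Mod0_modR R TYPE('m) \<and>
    nat_trans R F0 F \<iota> \<and> nat_trans R F (homF R nuF) \<eta> \<and> nat_trans R (homF R nuF) F1 \<rho> \<and>
    ntr_mono R F0 \<iota> \<and>
    ntr_exact R F0 \<iota> F \<eta> (homF R nuF) \<and>
    ntr_exact R F \<eta> (homF R nuF) \<rho> F1 \<and>
    ntr_epi R (homF R nuF) F1 \<rho>"
proof -
  note F = assms(2)
  let ?H = "homF R nuF"
  obtain M2 :: "('r, 'm) rmod" and d2 M1 d1 M0 \<epsilon>
    where res: "special_flat_resolution R M2 d2 M1 d1 M0 \<epsilon> F"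
      and coker: "rmod_iso R nuF (rcoker M1 M0 d1)" and N: "right_module R nuF"
    using assms(3) unfolding is_nu_def by blast
  have M1: "right_module R M1" and M0: "right_module R M0" and d1: "d1 \<in> rhom R M1 M0"
    and \<epsilon>: "nat_trans R (homF R M0) F \<epsilon>" and epi: "ntr_epi R (homF R M0) F \<epsilon>"
    and ex: "ntr_exact R (homF R M1) (homF_map d1) (homF R M0) \<epsilon> F"
    using res unfolding special_flat_resolution_def by blast+
  have ring: "ring R" by (rule right_module.ring_R[OF N])
  note H = homF_Mod_modR[OF N]
  obtain p where p: "p \<in> rhom R M0 nuF" and p_surj: "p ` carrier M0 = carrier nuF"
    and p_ker: "kernel M0 nuF p = d1 ` carrier M1"
    by (rule rcoker_projection[OF M0 M1 N d1 coker])
  have ker_\<epsilon>: "kernel (Obj (homF R M0) A) (Obj F A) (\<epsilon> A) = homF_map d1 A ` rhom R A M1"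
    if "A \<in> modR R" for A
    using ex that unfolding ntr_exact_def by simp
  have pd: "p (d1 x) = \<one>\<^bsub>nuF\<^esub>" if "x \<in> carrier M1" for x
    using p_ker that by (auto simp: kernel_def)
  \<comment> \<open>By exactness, what \<open>\<epsilon>\<close> kills is a composite of
    \<open>d1\<close> with some \<open>h\<close>, and \<open>p\<close> vanishes on the image of
    \<open>d1\<close>.\<close>
  have ker_p: "kernel (Obj (homF R M0) A) (Obj F A) (\<epsilon> A)
      \<subseteq> kernel (Obj (homF R M0) A) (Obj ?H A) (homF_map p A)" if A: "A \<in> modR R" for A
  proof -
    have "compose (carrier A) d1 h \<in> rhom R A M0" if "h \<in> rhom R A M1" for h
      by (rule rhom_compose[OF modRD[OF A] that d1])
    then show ?thesis
      unfolding ker_\<epsilon>[OF A]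
      by (auto simp: kernel_def homF_map_def compose_def pd rhomD(3) intro!: restrict_ext)
  qed
  obtain \<eta> where \<eta>: "nat_trans R F ?H \<eta>"
    and \<eta>_eq: "\<And>A g. \<lbrakk>A \<in> modR R; g \<in> carrier (Obj (homF R M0) A)\<rbrakk>
      \<Longrightarrow> \<eta> A (\<epsilon> A g) = homF_map p A g"
    using factor_through_epi[OF F homF_Mod_modR[OF M0] H \<epsilon> epi homF_map_nat_trans[OF p] ker_p]
    by blast
  interpret functor_coker R F ?H \<eta> by (rule functor_coker.intro[OF F H \<eta>])
  have F0: "ker_fun F ?H \<eta> \<in> Mod0_modR R TYPE('m)"
  proof (rule Mod0_modRI[OF ring ker_fun_Mod_modR[OF F H \<eta>]])
    fix A assume A: "A \<in> modR R" and iso: "rmod_iso R A (regular_rmod R)"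
    interpret e: group_hom "Obj (homF R M0) A" "Obj F A" "\<epsilon> A"
      by (rule nat_trans_group_hom[OF homF_Mod_modR[OF M0] F \<epsilon> A])
    interpret h: group_hom "Obj F A" "Obj ?H A" "\<eta> A" by (rule nat_trans_group_hom[OF F H \<eta> A])
    \<comment> \<open>Injectivity of \<open>\<eta>\<close> at the ring. Write \<open>x\<close> as
      \<open>\<epsilon> A g\<close>. If \<open>\<eta> A x\<close> is zero, then \<open>g\<close>
      takes values in the kernel of \<open>p\<close>, which is the image of
      \<open>d1\<close>.\<close>
    have "x = \<one>\<^bsub>Obj F A\<^esub>" if x: "x \<in> carrier (Obj F A)" "\<eta> A x = \<one>\<^bsub>Obj ?H A\<^esub>" for x
    proof -
      obtain g where g: "g \<in> rhom R A M0" "x = \<epsilon> A g"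
        using epi A x(1) unfolding ntr_epi_def by force
      have "homF_map p A g = (\<lambda>a\<in>carrier A. \<one>\<^bsub>nuF\<^esub>)"
        using x(2) \<eta>_eq[OF A, of g] g by simp
      then have "p (g a) = \<one>\<^bsub>nuF\<^esub>" if "a \<in> carrier A" for a
        using that by (metis homF_map_def compose_eq restrict_apply')
      then have "g ` carrier A \<subseteq> d1 ` carrier M1"
        unfolding p_ker[symmetric] kernel_def using rhomD(3)[OF g(1)] by auto
      \<comment> \<open>Projectivity lifts \<open>g\<close> through \<open>d1\<close>, and
        \<open>\<epsilon>\<close> kills whatever comes from \<open>d1\<close>.\<close>
      from regular_lift[OF modRD[OF A] M1 M0 iso d1 g(1) this]
      have "g \<in> homF_map d1 A ` rhom R A M1" by (auto simp: homF_map_def)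
      then show ?thesis using g(2) ker_\<epsilon>[OF A] by (auto simp: kernel_def)
    qed
    then show "zero_grp (Obj (ker_fun F ?H \<eta>) A)"
      by (auto simp: zero_grp_def ker_fun_def kernel_def simp del: homF_simps)
  qed
  have F1: "C \<in> Mod0_modR R TYPE('m)"
  proof (rule Mod0_modRI[OF ring C_Mod_modR])
    fix A assume A: "A \<in> modR R" and iso: "rmod_iso R A (regular_rmod R)"
    \<comment> \<open>Surjectivity of \<open>\<eta>\<close> at the ring: \<open>f\<close> lifts
      along the surjection \<open>p\<close> to some \<open>g\<close>, and then
      \<open>\<epsilon> A g\<close> is a preimage of \<open>f\<close> under
      \<open>\<eta> A\<close>.\<close>
    have "f \<in> im A" if f: "f \<in> rhom R A nuF" for f
    proof -
      have "f ` carrier A \<subseteq> p ` carrier M0" using rhomD(3)[OF f] p_surj by auto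
      from regular_lift[OF modRD[OF A] M0 N iso p f this]
      obtain g where g: "g \<in> rhom R A M0" "f = homF_map p A g" by (auto simp: homF_map_def)
      moreover have "\<epsilon> A g \<in> carrier (Obj F A)"
        using nat_transD(1)[OF \<epsilon> A] g(1) by (auto simp: hom_def)
      ultimately show ?thesis using \<eta>_eq[OF A, of g] by force
    qed
    then show "zero_grp (Obj C A)" by (intro zero_C[OF A]) auto
  qed
  show ?thesis
    using F0 F1 ker_fun_inclusion[of R F ?H \<eta>] \<eta> proj_nat_trans proj_exact proj_epi by blast
qed

end
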